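(* Let $(D,G_o)$ be a two-sender unicast index-coding (TSUIC) problem with $t$-bit messages, $t\ge 1$. Then the optimal broadcast rate is $$\beta_t(D,G_o)=\min_{J_1,J_2}\ \frac{\lceil \log_2|\mathcal{J}_1|\rceil+\lceil\log_2|\mathcal{J}_2|\rceil}{t},$$ where the minimum is over all pairs of coloring functions $J_1$ (with color set $\mathcal{J}_1$) and $J_2$ (with color set $\mathcal{J}_2$) that together form a proper two-sender graph coloring of the confusion graph $\Gamma_t(D)$.
   Context: There are $N$ messages $\mathcal{M}=\{x_1,\dots,x_N\}$, $x_i\in\{0,1\}^t$, and $N$ receivers; receiver $r$ requests $x_r$ and knows $\{x_j: j\in N_D^+(r)\}$, where $D$ is a loopless digraph on $V(D)=\{1,\dots,N\}$ (the side-information digraph) and $N_D^+(r)$ is the out-neighborhood of $r$. Two senders $S_1,S_2$ know message sets $\mathcal{M}_1,\mathcal{M}_2$ with $\mathcal{M}_1\cup\mathcal{M}_2=\mathcal{M}$. A two-sender index code consists of encoding functions $\mathscr{F}_s:\{0,1\}^{|\mathcal{M}_s|t}\to\{0,1\}^{p_s}$, $s=1,2$ ($p_s$ a non-negative integer), applied to the messages in $\mathcal{M}_s$, and decoding functions for which every receiver $r$ recovers $x_r$, for all message realizations, from $\mathscr{F}_1(\mathcal{M}_1),\mathscr{F}_2(\mathcal{M}_2)$ and its side information. $\beta_t(D,G_o)$ is the minimum of $(p_1+p_2)/t$ over all two-sender index codes. Here $G_o$ (the sender-constraint graph, which has vertex set $V(D)$ and an edge between $i$ and $j$ iff one of $x_i,x_j$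 lies in $\mathcal{M}_1\setminus\mathcal{M}_2$ and the other in $\mathcal{M}_2\setminus\mathcal{M}_1$) records the senders' message sets. Let $n_1,n_2,n_3$ be the numbers of messages in $\mathcal{P}_1=\mathcal{M}_1\setminus\mathcal{M}_2$, $\mathcal{P}_2=\mathcal{M}_2\setminus\mathcal{M}_1$, $\mathcal{P}_3=\mathcal{M}_1\cap\mathcal{M}_2$, so $N=n_1+n_2+n_3$. A message realization is written $(b_1,b_2,b_3)$ with $b_i\in\{0,1\}^{tn_i}$ the bits of the messages in $\mathcal{P}_i$. Confusion graph $\Gamma_t(D)$: the undirected graph whose vertices are all message realizations $u=(u_1,\dots,u_N)$, $u_i\in\{0,1\}^t$; $u$ and $v$ are adjacent iff they are confusable at some receiver $r$, i.e. $u_r\ne v_r$ and $u_i=v_i$ for all $i\in N_D^+(r)$. Two-sender graph coloring: let $J_1:\{0,1\}^{tn_1}\times\{0,1\}^{tn_3}\to\mathcal{J}_1$ and $J_2:\{0,1\}^{tn_2}\times\{0,1\}^{tn_3}\to\mathcal{J}_2$ be two onto functions (the coloring functions carried out by $S_1$ and $S_2$, respectively). A proper two-sender graph coloring of $\Gamma_t(D)$ is an onto function $J_o:\{0,1\}^{tn_1}\times\{0,1\}^{tn_2}\times\{0,1\}^{tn_3}\to\mathcal{J}_1\times\mathcal{J}_2$ with $J_o(b_1,b_2,b_3)=(J_1(b_1,b_3),J_2(b_2,b_3))$ such that adjacent vertices of $\Gamma_t(D)$ always receive different ordered pairs.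
   Formalization: The joint coloring J_o is not required to be onto the full product of the two color sets; only J_1 and J_2 are required to be onto their own color sets, because with J_o onto the product the claimed equality can fail. *)

theory Defs
  imports Complex_Main "HOL-Library.FuncSet"
begin

definition bits :: "nat \<Rightarrow> bool list set" where
  "bits n = {w. length w = n}"

text \<open>
  An element of \<open>realizations t S\<close> assigns a \<open>t\<close>-bit word to every message index in \<open>S\<close>
  (and is undefined elsewhere), so this set stands for $\{0,1\}^{t|S|}$.
\<close>

definition realizations :: "nat \<Rightarrow> nat set \<Rightarrow> (nat \<Rightarrow> bool list) set" where
  "realizations t S = (\<Pi>\<^sub>E i\<in>S. bits t)"

definition sender_constraint_edges :: "nat set \<Rightarrow> nat set \<Rightarrow> nat set set" where
  "sender_constraint_edges M1 M2 = {{i, j} | i j. i \<in> M1 - M2 \<and> j \<in> M2 - M1}"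

text \<open>
  Messages and receivers are indexed by \<open>{1..N}\<close>. The digraph is given by its set of arcs \<open>D\<close>;
  the out-neighbourhood of \<open>r\<close> is \<open>D `` {r}\<close>. The sets \<open>M1\<close> and \<open>M2\<close> hold the indices of
  the messages known to the two senders; \<open>Go\<close> is the edge set of the graph on \<open>{1..N}\<close> that
  records them.
\<close>

definition tsuic_problem ::
  "nat \<Rightarrow> (nat \<times> nat) set \<Rightarrow> nat set set \<Rightarrow> nat set \<Rightarrow> nat set \<Rightarrow> bool" where
  "tsuic_problem N D Go M1 M2 \<longleftrightarrow>
     D \<subseteq> {1..N} \<times> {1..N} \<and> irrefl D \<and>
     M1 \<union> M2 = {1..N} \<and> Go = sender_constraint_edges M1 M2"

definition two_sender_index_code ::
  "nat \<Rightarrow> nat \<Rightarrow> (nat \<times> nat) set \<Rightarrow> nat set \<Rightarrow> nat set \<Rightarrow> nat \<Rightarrow> nat \<Rightarrow>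
   ((nat \<Rightarrow> bool list) \<Rightarrow> bool list) \<Rightarrow> ((nat \<Rightarrow> bool list) \<Rightarrow> bool list) \<Rightarrow>
   (nat \<Rightarrow> bool list \<Rightarrow> bool list \<Rightarrow> (nat \<Rightarrow> bool list) \<Rightarrow> bool list) \<Rightarrow> bool" where
  "two_sender_index_code t N D M1 M2 p1 p2 F1 F2 dec \<longleftrightarrow>
     F1 \<in> realizations t M1 \<rightarrow> bits p1 \<and>
     F2 \<in> realizations t M2 \<rightarrow> bits p2 \<and>
     (\<forall>r\<in>{1..N}. \<forall>x\<in>realizations t {1..N}.
        dec r (F1 (restrict x M1)) (F2 (restrict x M2)) (restrict x (D `` {r})) = x r)"

definition index_code_rates ::
  "nat \<Rightarrow> nat \<Rightarrow> (nat \<times> nat) set \<Rightarrow> nat set \<Rightarrow> nat set \<Rightarrow> real set" where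
  "index_code_rates t N D M1 M2 =
     {real (p1 + p2) / real t | p1 p2.
        \<exists>F1 F2 dec. two_sender_index_code t N D M1 M2 p1 p2 F1 F2 dec}"

definition optimal_broadcast_rate ::
  "nat \<Rightarrow> nat \<Rightarrow> (nat \<times> nat) set \<Rightarrow> nat set \<Rightarrow> nat set \<Rightarrow> real" where
  "optimal_broadcast_rate t N D M1 M2 = (LEAST \<rho>. \<rho> \<in> index_code_rates t N D M1 M2)"

definition confusable ::
  "(nat \<times> nat) set \<Rightarrow> nat \<Rightarrow> (nat \<Rightarrow> bool list) \<Rightarrow> (nat \<Rightarrow> bool list) \<Rightarrow> bool" where
  "confusable D r u v \<longleftrightarrow> u r \<noteq> v r \<and> (\<forall>i\<in>D `` {r}. u i = v i)"

text \<open>The edge set of the confusion graph, whose vertex set is \<open>realizations t {1..N}\<close>.\<close>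

definition confusion_edges ::
  "nat \<Rightarrow> nat \<Rightarrow> (nat \<times> nat) set \<Rightarrow> (nat \<Rightarrow> bool list) set set" where
  "confusion_edges t N D =
     {{u, v} | u v. u \<in> realizations t {1..N} \<and> v \<in> realizations t {1..N} \<and>
        (\<exists>r\<in>{1..N}. confusable D r u v)}"

fun joint_coloring ::
  "('b1 \<times> 'b3 \<Rightarrow> 'c1) \<Rightarrow> ('b2 \<times> 'b3 \<Rightarrow> 'c2) \<Rightarrow> 'b1 \<times> 'b2 \<times> 'b3 \<Rightarrow> 'c1 \<times> 'c2" where
  "joint_coloring J1 J2 (b1, b2, b3) = (J1 (b1, b3), J2 (b2, b3))"

text \<open>The decomposition $(b_1,b_2,b_3)$ of a message realization.\<close>

definition split_realization ::
  "nat set \<Rightarrow> nat set \<Rightarrow> (nat \<Rightarrow> bool list) \<Rightarrow>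
   (nat \<Rightarrow> bool list) \<times> (nat \<Rightarrow> bool list) \<times> (nat \<Rightarrow> bool list)" where
  "split_realization M1 M2 u =
     (restrict u (M1 - M2), restrict u (M2 - M1), restrict u (M1 \<inter> M2))"

text \<open>
  The colouring functions \<open>J1\<close> and \<open>J2\<close> are onto the colour sets \<open>C1\<close> and \<open>C2\<close>, so every
  colour counted in a rate is used. The joint colouring takes its values in \<open>C1 \<times> C2\<close>, but not
  every pair of colours has to occur: both colours depend on the common messages, and requiring
  all of \<open>C1 \<times> C2\<close> to be attained can increase the minimum rate strictly. Colour sets are
  finite, hence may be taken to be sets of natural numbers.
\<close>

definition proper_two_sender_coloring ::
  "nat \<Rightarrow> nat \<Rightarrow> (nat \<times> nat) set \<Rightarrow> nat set \<Rightarrow> nat set \<Rightarrow>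
   ((nat \<Rightarrow> bool list) \<times> (nat \<Rightarrow> bool list) \<Rightarrow> nat) \<Rightarrow> nat set \<Rightarrow>
   ((nat \<Rightarrow> bool list) \<times> (nat \<Rightarrow> bool list) \<Rightarrow> nat) \<Rightarrow> nat set \<Rightarrow> bool" where
  "proper_two_sender_coloring t N D M1 M2 J1 C1 J2 C2 \<longleftrightarrow>
     J1 ` (realizations t (M1 - M2) \<times> realizations t (M1 \<inter> M2)) = C1 \<and>
     J2 ` (realizations t (M2 - M1) \<times> realizations t (M1 \<inter> M2)) = C2 \<and>
     (\<forall>u v. {u, v} \<in> confusion_edges t N D \<longrightarrow>
        joint_coloring J1 J2 (split_realization M1 M2 u) \<noteq>
        joint_coloring J1 J2 (split_realization M1 M2 v))"

definition coloring_rates ::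
  "nat \<Rightarrow> nat \<Rightarrow> (nat \<times> nat) set \<Rightarrow> nat set \<Rightarrow> nat set \<Rightarrow> real set" where
  "coloring_rates t N D M1 M2 =
     {real_of_int (\<lceil>log 2 (real (card C1))\<rceil> + \<lceil>log 2 (real (card C2))\<rceil>) / real t | C1 C2.
        \<exists>J1 J2. proper_two_sender_coloring t N D M1 M2 J1 C1 J2 C2}"

definition is_minimum :: "'a::linorder \<Rightarrow> 'a set \<Rightarrow> bool" where
  "is_minimum m S \<longleftrightarrow> m \<in> S \<and> (\<forall>s\<in>S. m \<le> s)"

end

theory Submission
  imports Defs "HOL-Library.Countable"
begin

text \<open>
  Given the encoders, decoders exist iff no two confusable realizations have the same pair of
  codewords. Hence codewords of a two-sender code, viewed as colours, form a proper two-sender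
  colouring with at most \<open>2 ^ p\<close> colours for a sender using \<open>p\<close> bits; conversely, numbering the
  \<open>c\<close> colours of a sender by words of \<open>\<lceil>log 2 c\<rceil>\<close> bits turns a proper colouring into encoders
  that separate confusable realizations.
\<close>

section \<open>Counting words and realizations; word lengths for colours\<close>

lemma bits_eq_lists: "bits n = {w. set w \<subseteq> UNIV \<and> length w = n}"
  by (simp add: bits_def)

lemma finite_bits: "finite (bits n)"
  unfolding bits_eq_lists by (rule finite_lists_length_eq) simp

lemma card_bits: "card (bits n) = 2 ^ n"
  unfolding bits_eq_lists by (subst card_lists_length_eq) simp_all

lemma finite_realizations: "finite S \<Longrightarrow> finite (realizations t S)"
  by (simp add: realizations_def finite_PiE finite_bits)

lemma realizations_nonempty: "realizations t S \<noteq> {}"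
proof -
  have "replicate t True \<in> bits t" by (simp add: bits_def)
  then show ?thesis by (auto simp: realizations_def PiE_eq_empty_iff)
qed

lemma restrict_in_realizations:
  "x \<in> realizations t T \<Longrightarrow> S \<subseteq> T \<Longrightarrow> restrict x S \<in> realizations t S"
  by (auto simp: realizations_def)

lemma inj_into_bits:
  assumes "finite A" "card A \<le> 2 ^ p"
  obtains f where "f \<in> A \<rightarrow> bits p" "inj_on f A"
  using card_le_inj[OF assms(1) finite_bits, of p] assms(2) by (auto simp: card_bits)

lemma le_two_power_ceiling_log: "n \<le> 2 ^ nat \<lceil>log 2 (real n)\<rceil>"
proof (cases "n = 0")
  case False
  define p where "p = nat \<lceil>log 2 (real n)\<rceil>"
  have "log 2 (real n) \<le> real p" unfolding p_def by linarith
  then have "real n \<le> 2 ^ p"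
    using False by (simp add: log_le_iff powr_realpow)
  then have "n \<le> 2 ^ p" by simp
  then show ?thesis unfolding p_def .
qed simp

text \<open>Counterpart of \<open>le_two_power_ceiling_log\<close>: together they identify the
  ceiling of the logarithm as the least word length that can tell \<open>n\<close> colours
  apart.\<close>

lemma ceiling_log_le:
  assumes "n > 0" "n \<le> 2 ^ p"
  shows "\<lceil>log 2 (real n)\<rceil> \<le> int p"
proof -
  have "real n \<le> 2 ^ p" using assms(2) by simp
  then have "log 2 (real n) \<le> real p" using assms(1) by (simp add: log_le_iff powr_realpow)
  then show ?thesis by (simp add: ceiling_le_iff)
qed

section \<open>Confusion graph and decodability\<close>

lemma confusion_edges_iff:
  "{u, v} \<in> confusion_edges t N D \<longleftrightarrow>
     u \<in> realizations t {1..N} \<and> v \<in> realizations t {1..N} \<and> (\<exists>r\<in>{1..N}. confusable D r u v)"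
proof -
  \<comment> \<open>An edge is an unordered pair, so the pair witnessing it may be \<open>u\<close>,
    \<open>v\<close> in either order.\<close>
  have sym: "confusable D r a b \<longleftrightarrow> confusable D r b a" for r a b
    by (auto simp: confusable_def)
  show ?thesis
    unfolding confusion_edges_def by (auto simp: doubleton_eq_iff sym)
qed

text \<open>Decodability with the decoders eliminated: properness of a colouring, stated for
  encoders.\<close>

definition encoders_separate ::
  "nat \<Rightarrow> nat \<Rightarrow> (nat \<times> nat) set \<Rightarrow> nat set \<Rightarrow> nat set \<Rightarrow>
   ((nat \<Rightarrow> bool list) \<Rightarrow> 'a) \<Rightarrow> ((nat \<Rightarrow> bool list) \<Rightarrow> 'b) \<Rightarrow> bool" where
  "encoders_separate t N D M1 M2 F1 F2 \<longleftrightarrow>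
     (\<forall>u v. {u, v} \<in> confusion_edges t N D \<longrightarrow>
        (F1 (restrict u M1), F2 (restrict u M2)) \<noteq> (F1 (restrict v M1), F2 (restrict v M2)))"

text \<open>A receiver can fail only if two realizations look the same to it, in both codewords and
  in side information, yet differ in its requested message. That is a confusable pair with equal
  codeword pairs.\<close>

lemma decoder_exists_iff:
  "(\<exists>dec. two_sender_index_code t N D M1 M2 p1 p2 F1 F2 dec) \<longleftrightarrow>
     F1 \<in> realizations t M1 \<rightarrow> bits p1 \<and> F2 \<in> realizations t M2 \<rightarrow> bits p2 \<and>
     encoders_separate t N D M1 M2 F1 F2"
  (is "?code \<longleftrightarrow> ?F1 \<and> ?F2 \<and> ?sep")
proof
  assume ?code
  then obtain dec where code: "two_sender_index_code t N D M1 M2 p1 p2 F1 F2 dec" by blast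
  have ?sep
    unfolding encoders_separate_def confusion_edges_iff
  proof (intro allI impI notI, elim conjE bexE)
    fix u v r
    assume uv: "u \<in> realizations t {1..N}" "v \<in> realizations t {1..N}"
      and r: "r \<in> {1..N}" and conf: "confusable D r u v"
      and eq: "(F1 (restrict u M1), F2 (restrict u M2)) = (F1 (restrict v M1), F2 (restrict v M2))"
    have side: "restrict u (D `` {r}) = restrict v (D `` {r})"
      using conf by (auto simp: confusable_def intro!: restrict_ext)
    have "dec r (F1 (restrict x M1)) (F2 (restrict x M2)) (restrict x (D `` {r})) = x r"
      if "x \<in> realizations t {1..N}" for x
      using code that r unfolding two_sender_index_code_def by blast
    from this[OF uv(1)] this[OF uv(2)] have "u r = v r"
      using eq side by simp
    then show False using conf by (simp add: confusable_def)
  qed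
  then show "?F1 \<and> ?F2 \<and> ?sep"
    using code unfolding two_sender_index_code_def by blast
next
  assume A: "?F1 \<and> ?F2 \<and> ?sep"
  \<comment> \<open>\<open>P\<close> collects the realizations consistent with what receiver
    \<open>r\<close> observes. The decoder picks any one of them and reads off its
    \<open>r\<close>-th message; separation makes the choice irrelevant.\<close>
  define P where "P r w1 w2 s x \<longleftrightarrow> x \<in> realizations t {1..N} \<and> F1 (restrict x M1) = w1 \<and>
    F2 (restrict x M2) = w2 \<and> restrict x (D `` {r}) = s" for r w1 w2 s x
  define dec where "dec r w1 w2 s = (SOME x. P r w1 w2 s x) r" for r w1 w2 s
  have "dec r (F1 (restrict x M1)) (F2 (restrict x M2)) (restrict x (D `` {r})) = x r"
    if r: "r \<in> {1..N}" and x: "x \<in> realizations t {1..N}" for r x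
  proof -
    define y where
      "y = (SOME y. P r (F1 (restrict x M1)) (F2 (restrict x M2)) (restrict x (D `` {r})) y)"
    have "\<exists>y. P r (F1 (restrict x M1)) (F2 (restrict x M2)) (restrict x (D `` {r})) y"
      unfolding P_def using x by blast
    then have y: "P r (F1 (restrict x M1)) (F2 (restrict x M2)) (restrict x (D `` {r})) y"
      unfolding y_def by (rule someI_ex)
    have "y i = x i" if "i \<in> D `` {r}" for i
    proof -
      have "restrict y (D `` {r}) i = restrict x (D `` {r}) i"
        using y unfolding P_def by metis
      then show ?thesis using that by simp
    qed
    moreover have "\<not> confusable D r y x"
    proof
      assume "confusable D r y x"
      then have "{y, x} \<in> confusion_edges t N D"
        using x y r unfolding confusion_edges_iff P_def by blast
      then have "(F1 (restrict y M1), F2 (restrict y M2)) \<noteq> (F1 (restrict x M1), F2 (restrict x M2))"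
        using A unfolding encoders_separate_def by blast
      then show False using y unfolding P_def by blast
    qed
    ultimately have "y r = x r"
      by (auto simp: confusable_def)
    then show ?thesis by (simp add: dec_def y_def)
  qed
  then show ?code
    using A unfolding two_sender_index_code_def by blast
qed

lemma index_code_rate_iff:
  "\<rho> \<in> index_code_rates t N D M1 M2 \<longleftrightarrow>
     (\<exists>p1 p2 F1 F2. \<rho> = real (p1 + p2) / real t \<and>
        F1 \<in> realizations t M1 \<rightarrow> bits p1 \<and> F2 \<in> realizations t M2 \<rightarrow> bits p2 \<and>
        encoders_separate t N D M1 M2 F1 F2)"
  unfolding index_code_rates_def mem_Collect_eq decoder_exists_iff by blast

section \<open>From colourings to codes\<close>

lemma coloring_rate_imp_index_code_rate:
  assumes "M1 \<union> M2 = {1..N}" and "\<rho> \<in> coloring_rates t N D M1 M2"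
  shows "\<rho> \<in> index_code_rates t N D M1 M2"
proof -
  obtain C1 C2 J1 J2 where
    \<rho>: "\<rho> = real_of_int (\<lceil>log 2 (real (card C1))\<rceil> + \<lceil>log 2 (real (card C2))\<rceil>) / real t"
    and J: "proper_two_sender_coloring t N D M1 M2 J1 C1 J2 C2"
    using assms(2) unfolding coloring_rates_def by blast
  have C1: "C1 = J1 ` (realizations t (M1 - M2) \<times> realizations t (M1 \<inter> M2))"
    and C2: "C2 = J2 ` (realizations t (M2 - M1) \<times> realizations t (M1 \<inter> M2))"
    using J by (simp_all add: proper_two_sender_coloring_def)
  have fin: "finite M1" "finite M2"
    using assms(1) by (metis finite_Un finite_atLeastAtMost)+
  have finC: "finite C1" "finite C2"
    unfolding C1 C2 using fin by (simp_all add: finite_realizations)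
  have "C1 \<noteq> {}" "C2 \<noteq> {}"
    unfolding C1 C2 by (simp_all add: realizations_nonempty)
  then have pos: "card C1 > 0" "card C2 > 0"
    using finC by (simp_all add: card_gt_0_iff)
  define p1 where "p1 = nat \<lceil>log 2 (real (card C1))\<rceil>"
  define p2 where "p2 = nat \<lceil>log 2 (real (card C2))\<rceil>"
  \<comment> \<open>Nonempty colour sets make the logarithms nonnegative, so \<open>nat\<close>
    truncates nothing and the code has exactly the rate of the colouring.\<close>
  have "log 2 (real (card C1)) \<ge> 0" "log 2 (real (card C2)) \<ge> 0"
    using pos by (simp_all add: Suc_le_eq)
  then have p: "\<lceil>log 2 (real (card C1))\<rceil> = int p1" "\<lceil>log 2 (real (card C2))\<rceil> = int p2"
    unfolding p1_def p2_def by linarith+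
  obtain f1 where f1: "f1 \<in> C1 \<rightarrow> bits p1" "inj_on f1 C1"
    using inj_into_bits[OF finC(1)] le_two_power_ceiling_log[of "card C1"] p1_def by metis
  obtain f2 where f2: "f2 \<in> C2 \<rightarrow> bits p2" "inj_on f2 C2"
    using inj_into_bits[OF finC(2)] le_two_power_ceiling_log[of "card C2"] p2_def by metis
  define F1 where "F1 y = f1 (J1 (restrict y (M1 - M2), restrict y (M1 \<inter> M2)))" for y
  define F2 where "F2 y = f2 (J2 (restrict y (M2 - M1), restrict y (M1 \<inter> M2)))" for y
  have color1: "J1 (restrict y (M1 - M2), restrict y (M1 \<inter> M2)) \<in> C1"
    if "y \<in> realizations t S" "M1 \<subseteq> S" for y S
    unfolding C1 using that by (auto intro!: imageI restrict_in_realizations)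
  have color2: "J2 (restrict y (M2 - M1), restrict y (M1 \<inter> M2)) \<in> C2"
    if "y \<in> realizations t S" "M2 \<subseteq> S" for y S
    unfolding C2 using that by (auto intro!: imageI restrict_in_realizations)
  have F1: "F1 \<in> realizations t M1 \<rightarrow> bits p1" and F2: "F2 \<in> realizations t M2 \<rightarrow> bits p2"
    using f1(1) f2(1) color1 color2 unfolding F1_def F2_def by blast+
  have M: "M1 \<subseteq> {1..N}" "M2 \<subseteq> {1..N}" using assms(1) by auto
  have restr: "M1 \<inter> (M1 - M2) = M1 - M2" "M1 \<inter> (M1 \<inter> M2) = M1 \<inter> M2"
    "M2 \<inter> (M2 - M1) = M2 - M1" "M2 \<inter> (M1 \<inter> M2) = M1 \<inter> M2"
    by auto
  have "encoders_separate t N D M1 M2 F1 F2"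
    unfolding encoders_separate_def
  proof (intro allI impI notI)
    fix u v
    assume edge: "{u, v} \<in> confusion_edges t N D"
      and eq: "(F1 (restrict u M1), F2 (restrict u M2)) = (F1 (restrict v M1), F2 (restrict v M2))"
    have uv: "u \<in> realizations t {1..N}" "v \<in> realizations t {1..N}"
      using edge by (simp_all add: confusion_edges_iff)
    \<comment> \<open>Both blocks on which a sender's colour depends lie inside its own message set,
      so the sender computes the colour of the full realization \<open>x\<close>.\<close>
    have color_eq: "F1 (restrict x M1) = f1 (J1 (restrict x (M1 - M2), restrict x (M1 \<inter> M2)))"
      "F2 (restrict x M2) = f2 (J2 (restrict x (M2 - M1), restrict x (M1 \<inter> M2)))" for x
      unfolding F1_def F2_def restrict_restrict restr by (rule refl)+
    have "J1 (restrict u (M1 - M2), restrict u (M1 \<inter> M2)) =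
        J1 (restrict v (M1 - M2), restrict v (M1 \<inter> M2))"
      using eq unfolding color_eq
      by (intro inj_onD[OF f1(2) _ color1[OF uv(1) M(1)] color1[OF uv(2) M(1)]]) blast
    moreover have "J2 (restrict u (M2 - M1), restrict u (M1 \<inter> M2)) =
        J2 (restrict v (M2 - M1), restrict v (M1 \<inter> M2))"
      using eq unfolding color_eq
      by (intro inj_onD[OF f2(2) _ color2[OF uv(1) M(2)] color2[OF uv(2) M(2)]]) blast
    ultimately have "joint_coloring J1 J2 (split_realization M1 M2 u) =
        joint_coloring J1 J2 (split_realization M1 M2 v)"
      unfolding split_realization_def joint_coloring.simps by (rule arg_cong2)
    then show False
      using J edge unfolding proper_two_sender_coloring_def by blast
  qed
  moreover have "\<rho> = real (p1 + p2) / real t"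
    unfolding \<rho> p by simp
  ultimately show ?thesis
    using F1 F2 unfolding index_code_rate_iff by blast
qed

section \<open>From codes to colourings\<close>

definition merge :: "nat set \<Rightarrow> (nat \<Rightarrow> bool list) \<times> (nat \<Rightarrow> bool list) \<Rightarrow> nat \<Rightarrow> bool list" where
  "merge S = (\<lambda>(a, c) i. if i \<in> S then a i else c i)"

text \<open>Encoders read one realization of a message set, colourings a pair of blocks;
  \<open>merge\<close> glues the private block (on \<open>S\<close>) to the common one.\<close>

lemma merge_in_realizations:
  assumes "a \<in> realizations t S" "c \<in> realizations t T"
  shows "merge S (a, c) \<in> realizations t (S \<union> T)"
  using assms by (auto simp: realizations_def merge_def PiE_iff extensional_def)

lemma merge_restrict: "merge S (restrict u S, restrict u T) = restrict u (S \<union> T)"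
  by (auto simp: merge_def)

lemma index_code_rate_imp_coloring_rate:
  assumes "\<rho> \<in> index_code_rates t N D M1 M2"
  obtains \<rho>' where "\<rho>' \<in> coloring_rates t N D M1 M2" "\<rho>' \<le> \<rho>"
proof -
  obtain p1 p2 F1 F2 where \<rho>: "\<rho> = real (p1 + p2) / real t"
    and F1: "F1 \<in> realizations t M1 \<rightarrow> bits p1" and F2: "F2 \<in> realizations t M2 \<rightarrow> bits p2"
    and sep: "encoders_separate t N D M1 M2 F1 F2"
    using assms unfolding index_code_rate_iff by blast
  \<comment> \<open>Colours must be natural numbers, so codewords pass through the injection
    \<open>to_nat\<close>, which keeps distinct codewords distinct.\<close>
  define J1 :: "_ \<Rightarrow> nat" where "J1 y = to_nat (F1 (merge (M1 - M2) y))" for y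
  define J2 :: "_ \<Rightarrow> nat" where "J2 y = to_nat (F2 (merge (M2 - M1) y))" for y
  define C1 where "C1 = J1 ` (realizations t (M1 - M2) \<times> realizations t (M1 \<inter> M2))"
  define C2 where "C2 = J2 ` (realizations t (M2 - M1) \<times> realizations t (M1 \<inter> M2))"
  have un: "M1 - M2 \<union> M1 \<inter> M2 = M1" "M2 - M1 \<union> M1 \<inter> M2 = M2" by auto
  have "J1 y \<in> to_nat ` bits p1" if "y \<in> realizations t (M1 - M2) \<times> realizations t (M1 \<inter> M2)" for y
    using that F1 merge_in_realizations[of _ t "M1 - M2" _ "M1 \<inter> M2"] un unfolding J1_def by auto
  then have sub1: "C1 \<subseteq> to_nat ` bits p1" unfolding C1_def by blast
  have "J2 y \<in> to_nat ` bits p2" if "y \<in> realizations t (M2 - M1) \<times> realizations t (M1 \<inter> M2)" for y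
    using that F2 merge_in_realizations[of _ t "M2 - M1" _ "M1 \<inter> M2"] un unfolding J2_def by auto
  then have sub2: "C2 \<subseteq> to_nat ` bits p2" unfolding C2_def by blast
  have bound: "\<lceil>log 2 (real (card C))\<rceil> \<le> int p"
    if "C \<subseteq> to_nat ` bits p" "C \<noteq> {}" for C p
  proof (rule ceiling_log_le)
    have fin: "finite (to_nat ` bits p)" by (simp add: finite_bits)
    show "card C > 0" using that finite_subset[OF that(1) fin] by (simp add: card_gt_0_iff)
    show "card C \<le> 2 ^ p"
      using card_mono[OF fin that(1)] card_image_le[OF finite_bits, of to_nat p]
      by (simp add: card_bits)
  qed
  have nonempty: "C1 \<noteq> {}" "C2 \<noteq> {}"
    unfolding C1_def C2_def by (simp_all add: realizations_nonempty)
  \<comment> \<open>Merging undoes the splitting, so the joint colour is the codeword pair up to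
    \<open>to_nat\<close>, and separation becomes properness.\<close>
  have "joint_coloring J1 J2 (split_realization M1 M2 x) =
      (to_nat (F1 (restrict x M1)), to_nat (F2 (restrict x M2)))" for x
    by (simp add: split_realization_def J1_def J2_def merge_restrict un)
  then have "proper_two_sender_coloring t N D M1 M2 J1 C1 J2 C2"
    using sep unfolding proper_two_sender_coloring_def encoders_separate_def
    by (simp add: C1_def C2_def)
  then have "real_of_int (\<lceil>log 2 (real (card C1))\<rceil> + \<lceil>log 2 (real (card C2))\<rceil>) / real t
      \<in> coloring_rates t N D M1 M2"
    unfolding coloring_rates_def by blast
  moreover have "\<lceil>log 2 (real (card C1))\<rceil> + \<lceil>log 2 (real (card C2))\<rceil> \<le> int (p1 + p2)"
    using bound[OF sub1 nonempty(1)] bound[OF sub2 nonempty(2)] by simp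
  then have "real_of_int (\<lceil>log 2 (real (card C1))\<rceil> + \<lceil>log 2 (real (card C2))\<rceil>) / real t \<le> \<rho>"
    unfolding \<rho> by (intro divide_right_mono) linarith+
  ultimately show ?thesis using that by blast
qed

section \<open>Attainment of the optimal rate\<close>

lemma index_code_rates_nonempty:
  assumes "M1 \<union> M2 = {1..N}"
  shows "index_code_rates t N D M1 M2 \<noteq> {}"
proof -
  have fin: "finite (realizations t M1)" "finite (realizations t M2)"
    using assms by (metis finite_Un finite_atLeastAtMost finite_realizations)+
  \<comment> \<open>Each sender transmits an injective description of all it knows; any sufficient
    length will do, and n < 2 ^ n makes the number of realizations one.\<close>
  obtain F1 where F1: "F1 \<in> realizations t M1 \<rightarrow> bits (card (realizations t M1))"
      "inj_on F1 (realizations t M1)"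
    using inj_into_bits[OF fin(1) less_imp_le[OF less_exp]] by blast
  obtain F2 where F2: "F2 \<in> realizations t M2 \<rightarrow> bits (card (realizations t M2))"
      "inj_on F2 (realizations t M2)"
    using inj_into_bits[OF fin(2) less_imp_le[OF less_exp]] by blast
  have M: "M1 \<subseteq> {1..N}" "M2 \<subseteq> {1..N}" using assms by auto
  have "encoders_separate t N D M1 M2 F1 F2"
    unfolding encoders_separate_def confusion_edges_iff
  proof (intro allI impI notI, elim conjE bexE)
    fix u v r
    assume uv: "u \<in> realizations t {1..N}" "v \<in> realizations t {1..N}"
      and r: "r \<in> {1..N}" and conf: "confusable D r u v"
      and eq: "(F1 (restrict u M1), F2 (restrict u M2)) = (F1 (restrict v M1), F2 (restrict v M2))"
    have "restrict u M1 = restrict v M1" "restrict u M2 = restrict v M2"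
      using eq F1(2) F2(2) uv M by (auto simp: inj_on_def restrict_in_realizations)
    moreover have "r \<in> M1 \<or> r \<in> M2" using r assms by blast
    ultimately have "u r = v r" by (metis restrict_apply')
    then show False using conf by (simp add: confusable_def)
  qed
  then show ?thesis using F1(1) F2(1) index_code_rate_iff by blast
qed

text \<open>\<open>LEAST\<close> over the reals is meaningful only if a least element exists. Here
  every rate is a natural number over \<open>t\<close>, so well-ordering of the numerators supplies
  it.\<close>

lemma optimal_broadcast_rate_is_minimum:
  assumes "M1 \<union> M2 = {1..N}"
  shows "is_minimum (optimal_broadcast_rate t N D M1 M2) (index_code_rates t N D M1 M2)"
proof -
  let ?R = "index_code_rates t N D M1 M2"
  define k where "k = (LEAST k. real k / real t \<in> ?R)"
  have rate: "\<exists>k. \<rho> = real k / real t" if "\<rho> \<in> ?R" for \<rho>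
    using that unfolding index_code_rates_def by blast
  have k: "real k / real t \<in> ?R"
    unfolding k_def using index_code_rates_nonempty[OF assms] rate by (metis LeastI ex_in_conv)
  have least: "real k / real t \<le> \<rho>" if \<rho>: "\<rho> \<in> ?R" for \<rho>
  proof -
    obtain j where j: "\<rho> = real j / real t" using rate[OF \<rho>] by blast
    then have "k \<le> j" unfolding k_def using \<rho> by (auto intro: Least_le)
    then show ?thesis unfolding j by (intro divide_right_mono) simp_all
  qed
  have "optimal_broadcast_rate t N D M1 M2 = real k / real t"
    unfolding optimal_broadcast_rate_def using k least by (rule Least_equality)
  then show ?thesis using k least by (simp add: is_minimum_def)
qed

theorem theorem2:
  fixes N t :: nat
    and D :: "(nat \<times> nat) set"
    and Go :: "nat set set"
    and M1 M2 :: "nat set"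
  assumes "tsuic_problem N D Go M1 M2"
    and "t \<ge> 1"
  shows "is_minimum (optimal_broadcast_rate t N D M1 M2) (coloring_rates t N D M1 M2)"
proof -
  have M: "M1 \<union> M2 = {1..N}" using assms(1) by (simp add: tsuic_problem_def)
  note opt = optimal_broadcast_rate_is_minimum[OF M, of t D]
  note sub = coloring_rate_imp_index_code_rate[OF M, of _ t D]
  \<comment> \<open>An optimal code yields a colouring of no larger rate. As colouring rates are
    themselves code rates, equality is forced, and the minimum over all code rates is attained by a
    colouring.\<close>
  obtain \<rho> where \<rho>: "\<rho> \<in> coloring_rates t N D M1 M2"
      "\<rho> \<le> optimal_broadcast_rate t N D M1 M2"
    using opt index_code_rate_imp_coloring_rate unfolding is_minimum_def by metis
  then have "\<rho> = optimal_broadcast_rate t N D M1 M2"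
    using opt sub by (force simp: is_minimum_def)
  then show ?thesis
    using \<rho>(1) opt sub by (simp add: is_minimum_def)
qed

end
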